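(* Let $E$ be a Fréchet space whose topology is defined by an increasing family of seminorms $(\|\cdot\|_n)_{n \ge 0}$. Let $\theta : \mathbb{R}^+ \to \mathbb{R}^+$ be an increasing and subadditive map such that $\theta(0) = 0$ and $\theta(x) \to 1$ as $x \to +\infty$. Assume that $\theta$ is absolutely continuous, and that there exist $\alpha, m, M > 0$ and a constant $C > 0$ such that \[ \theta(t) \le C\, t^{\alpha} \ \text{ for all } 0 < t < m, \qquad 1 - \theta(t) \le C\, t^{-\alpha} \ \text{ for all } t > M. \] Let $r = (r_n)_{n \ge 0}$ be a summable sequence of positive real numbers, and set \[ d_{(\theta,r)}(x,y) = \sum_{n \ge 0} r_n\, \theta(\|x-y\|_n), \qquad x,y \in E. \] Then for every continuous linear map $T : E \to E$, the following two conditions are equivalent: (i) for all $x \in E$, $d_{(\theta,r)}(Tx, 0) = d_{(\theta,r)}(x,0)$; (ii) for all $x \in E$ and all $n \ge 0$, $\|Tx\|_n = \|x\|_n$.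
   Context: $\mathbb{R}^+ = [0,+\infty)$. "Increasing" is understood in the weak sense (non-decreasing); an increasing family of seminorms means $\|x\|_n \le \|x\|_{n+1}$ for all $x \in E$, $n \ge 0$. Positive means $> 0$. Subadditive means $\theta(s+t) \le \theta(s) + \theta(t)$ for all $s,t \ge 0$. The definition of absolute continuity used is: a map $\theta : I \subset \mathbb{R} \to \mathbb{R}$ is absolutely continuous if $\theta$ has a derivative $\theta'$ almost everywhere which is integrable in $I$. *)

theory Defs
  imports "HOL-Analysis.Analysis"
begin

text \<open>
  Scalars are real. A complex Frechet space is in particular a real one, with the same topology and
  seminorms, and its complex-linear maps are real-linear, so the complex case is included.
\<close>

definition seminorm :: "('a::real_vector \<Rightarrow> real) \<Rightarrow> bool" where
  "seminorm q \<longleftrightarrow>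
     (\<forall>x. 0 \<le> q x) \<and>
     (\<forall>x y. q (x + y) \<le> q x + q y) \<and>
     (\<forall>c x. q (c *\<^sub>R x) = \<bar>c\<bar> * q x)"

text \<open>The open semiballs of all centres and radii form a subbase of the topology.\<close>

definition topology_defined_by :: "('i \<Rightarrow> 'a::{real_vector, topological_space} \<Rightarrow> real) \<Rightarrow> bool" where
  "topology_defined_by p \<longleftrightarrow>
     (\<forall>U. open U \<longleftrightarrow> generate_topology {{y. p i (y - x) < e} | i x e. 0 < e} U)"

text \<open>
  Cauchy sequences for the translation-invariant uniform structure of a vector space with a topology:
  the double sequence of differences tends to 0.
\<close>

definition lin_Cauchy :: "(nat \<Rightarrow> 'a::{real_vector, topological_space}) \<Rightarrow> bool" where
  "lin_Cauchy X \<longleftrightarrow> ((\<lambda>(m, n). X m - X n) \<longlongrightarrow> 0) (sequentially \<times>\<^sub>F sequentially)"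

text \<open>
  The Hausdorff property is in the sort. Sequential completeness is completeness here, because the
  topology is defined by countably many seminorms.
\<close>

definition frechet_space :: "'a::{real_vector, t2_space} itself \<Rightarrow> bool" where
  "frechet_space (_ :: 'a itself) \<longleftrightarrow>
     (\<exists>p :: nat \<Rightarrow> 'a \<Rightarrow> real. (\<forall>n. seminorm (p n)) \<and> topology_defined_by p) \<and>
     (\<forall>X :: nat \<Rightarrow> 'a. lin_Cauchy X \<longrightarrow> convergent X)"

text \<open>
  Only an almost everywhere derivative that is Lebesgue integrable is required; the function need not
  be the integral of that derivative. This is weaker than the usual notion of absolute continuity on
  a compact interval (the Cantor function satisfies it).
\<close>

definition absolutely_continuous_map :: "real set \<Rightarrow> (real \<Rightarrow> real) \<Rightarrow> bool" where
  "absolutely_continuous_map I f \<longleftrightarrow>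
     (\<exists>f'. (AE t in lebesgue. t \<in> I \<longrightarrow> (f has_real_derivative f' t) (at t within I)) \<and>
           set_integrable lebesgue I f')"

definition theta_dist ::
  "(real \<Rightarrow> real) \<Rightarrow> (nat \<Rightarrow> real) \<Rightarrow> (nat \<Rightarrow> 'a::real_vector \<Rightarrow> real) \<Rightarrow> 'a \<Rightarrow> 'a \<Rightarrow> real" where
  "theta_dist \<theta> r p x y = (\<Sum>n. r n * \<theta> (p n (x - y)))"

end

theory Submission
  imports Defs "HOL-Probability.Probability" "HOL-Complex_Analysis.Cauchy_Integral_Formula"
begin

text \<open>
  Applying condition (i) to all multiples of \<open>x\<close> shows that the weighted sums of \<open>\<theta> (t * a n)\<close> and
  \<open>\<theta> (t * b n)\<close> agree for all \<open>t > 0\<close>, where \<open>a n = p n (T x)\<close> and \<open>b n = p n x\<close>. On the logarithmic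
  scale, \<open>s \<mapsto> \<theta> (exp s)\<close> is the distribution function of a probability measure \<open>K\<close>, and these sums are
  the distribution functions of the convolutions of \<open>K\<close> with the laws of \<open>- ln a\<close> and \<open>- ln b\<close> under
  the weights \<open>r\<close>. The power bounds on \<open>\<theta>\<close> give \<open>K\<close> exponential tails, so its characteristic function
  is real analytic and its zeros are isolated. Hence \<open>K\<close> can be cancelled, and \<open>a\<close> and \<open>b\<close> are
  equidistributed. Since both sequences are increasing and every weight is positive, they coincide.
\<close>

section \<open>Analyticity of characteristic functions under exponential tails\<close>

text \<open>For real \<open>z\<close> the right-hand side is \<open>char M (t + z)\<close>, so this
  is its expansion around \<open>t\<close>, with a radius of convergence independent of
  \<open>t\<close>. Termwise integration of the exponential series is justified by the majorant
  \<open>exp (\<beta> * \<bar>x\<bar>)\<close>, which dominates all finite sums of norms of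
  terms.\<close>

lemma (in real_distribution) char_power_series:
  fixes \<beta> t :: real and z :: complex
  assumes int: "integrable M (\<lambda>x. exp (\<beta> * \<bar>x\<bar>))" and z: "norm z \<le> \<beta>"
  shows "(\<lambda>k. (CLINT x|M. iexp (t * x) * (\<i> * x) ^ k / fact k) * z ^ k) sums
    (CLINT x|M. iexp (t * x) * exp (\<i> * x * z))"
proof -
  let ?f = "\<lambda>k x. iexp (t * x) * (\<i> * complex_of_real x) ^ k / fact k * z ^ k"
  have nf: "norm (?f k x) = (norm z * \<bar>x\<bar>) ^ k / fact k" for k x
    by (simp add: norm_mult norm_power norm_divide power_mult_distrib)
  have sm: "(\<lambda>k. (norm z * \<bar>x\<bar>) ^ k / fact k) sums exp (norm z * \<bar>x\<bar>)" for x
    using exp_converges[of "norm z * \<bar>x\<bar>"] by (simp add: divide_inverse mult.commute)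
  have le: "(\<Sum>k\<in>A. norm (?f k x)) \<le> exp (\<beta> * \<bar>x\<bar>)" if "finite A" for A x
  proof -
    have "(\<Sum>k\<in>A. norm (?f k x)) \<le> (\<Sum>k. (norm z * \<bar>x\<bar>) ^ k / fact k)"
      unfolding nf using that sm[of x] by (intro sum_le_suminf) (auto simp: sums_iff)
    also have "\<dots> = exp (norm z * \<bar>x\<bar>)"
      using sm[of x] by (simp add: sums_iff)
    also have "\<dots> \<le> exp (\<beta> * \<bar>x\<bar>)"
      using z by (simp add: mult_right_mono)
    finally show ?thesis .
  qed
  have fint: "integrable M (?f k)" for k
  proof (rule Bochner_Integration.integrable_bound[OF int])
    show "AE x in M. norm (?f k x) \<le> norm (exp (\<beta> * \<bar>x\<bar>))"
      using le[of "{k}"] by simp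
  qed simp
  have "(\<lambda>k. (CLINT x|M. ?f k x)) sums (CLINT x|M. (\<Sum>k. ?f k x))"
  proof (rule sums_integral[OF fint])
    show "AE x in M. summable (\<lambda>k. norm (?f k x))"
      unfolding nf using sm by (auto simp: sums_iff)
    show "summable (\<lambda>k. LINT x|M. norm (?f k x))"
    proof (rule summableI_nonneg_bounded)
      fix n
      have "(\<Sum>k<n. LINT x|M. norm (?f k x)) = (LINT x|M. (\<Sum>k<n. norm (?f k x)))"
        by (intro Bochner_Integration.integral_sum[symmetric] integrable_norm fint)
      also have "\<dots> \<le> (LINT x|M. exp (\<beta> * \<bar>x\<bar>))"
        by (intro integral_mono int Bochner_Integration.integrable_sum integrable_norm fint le) auto
      finally show "(\<Sum>k<n. LINT x|M. norm (?f k x)) \<le> (LINT x|M. exp (\<beta> * \<bar>x\<bar>))" .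
    qed (auto intro!: integral_nonneg_AE)
  qed
  moreover have "(\<Sum>k. ?f k x) = iexp (t * x) * exp (\<i> * x * z)" for x
  proof -
    have "(\<lambda>k. iexp (t * x) * ((\<i> * x * z) ^ k /\<^sub>R fact k)) sums (iexp (t * x) * exp (\<i> * x * z))"
      by (intro sums_mult exp_converges)
    moreover have "iexp (t * x) * ((\<i> * x * z) ^ k /\<^sub>R fact k) = ?f k x" for k
      by (simp add: power_mult_distrib scaleR_conv_of_real divide_inverse)
    ultimately show ?thesis
      by (simp add: sums_iff)
  qed
  moreover have "(CLINT x|M. ?f k x) = (CLINT x|M. iexp (t * x) * (\<i> * x) ^ k / fact k) * z ^ k" for k
    by (rule integral_mult_left_zero)
  ultimately show ?thesis
    by simp
qed

text \<open>At a zero \<open>t\<close>, either some coefficient of the expansion around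
  \<open>t\<close> is nonzero, and the zero is isolated, or all coefficients vanish, and
  \<open>char M\<close> is zero within distance \<open>\<beta>\<close> of \<open>t\<close>. At other
  points continuity suffices.\<close>

lemma (in real_distribution) eventually_char_eq_0_or_neq_0:
  fixes \<beta> t :: real
  assumes int: "integrable M (\<lambda>x. exp (\<beta> * \<bar>x\<bar>))" and \<beta>: "0 < \<beta>"
  shows "(\<forall>\<^sub>F u in nhds t. char M u = 0) \<or> (\<forall>\<^sub>F u in at t. char M u \<noteq> 0)"
proof (cases "char M t = 0")
  case False
  have "\<forall>\<^sub>F u in at t. char M u \<noteq> 0"
    using isCont_char[of t] False unfolding isCont_def by (rule tendsto_imp_eventually_ne)
  then show ?thesis ..
next
  case True
  define a where "a k = (CLINT x|M. iexp (t * x) * (\<i> * x) ^ k / fact k)" for k :: nat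
  define f where "f z = (CLINT x|M. iexp (t * x) * exp (\<i> * x * z))" for z :: complex
  have sums: "(\<lambda>k. a k * (z - 0) ^ k) sums f z" if "norm (z - 0) < \<beta>" for z
    unfolding a_def f_def using char_power_series[OF int, of z t] that by simp
  have f_char: "f (of_real (u - t)) = char M u" for u
    unfolding f_def char_def
    by (intro Bochner_Integration.integral_cong refl) (simp add: exp_add[symmetric] algebra_simps)
  have f0: "f 0 = 0"
    using f_char[of t] True by simp
  show ?thesis
  proof (cases "\<exists>m>0. a m \<noteq> 0")
    case True
    then obtain m where "a m \<noteq> 0" "m > 0" by blast
    from powser_0_nonzero[OF \<beta> sums f0 this] obtain s
      where s: "0 < s" "\<And>z. z \<in> cball 0 s - {0} \<Longrightarrow> f z \<noteq> 0" by blast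
    have "char M u \<noteq> 0" if "u \<noteq> t" "dist u t < s" for u
    proof -
      have "complex_of_real (u - t) \<in> cball 0 s - {0}"
        using that by (auto simp: dist_real_def norm_of_real simp del: of_real_diff)
      then show ?thesis
        using s(2) f_char by metis
    qed
    then have "\<forall>\<^sub>F u in at t. char M u \<noteq> 0"
      using s(1) unfolding eventually_at by auto
    then show ?thesis ..
  next
    case False
    \<comment> \<open>The case assumption concerns only positive indices; the constant coefficient
      is \<open>f 0\<close>, that is, \<open>char M t\<close>.\<close>
    have "a 0 = 0"
      using sums[of 0] f0 \<beta> by (simp add: sums_iff powser_zero)
    then have a0: "a k = 0" for k
      using False by (metis gr0I)
    have "char M u = 0" if "dist u t < \<beta>" for u
      using sums[of "of_real (u - t)"] that unfolding f_char
      by (simp add: a0 sums_iff dist_real_def norm_of_real del: of_real_diff)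
    then have "\<forall>\<^sub>F u in nhds t. char M u = 0"
      using \<beta> unfolding eventually_nhds_metric by auto
    then show ?thesis ..
  qed
qed

text \<open>By the dichotomy, the points with a neighbourhood on which \<open>char M\<close>
  vanishes form a set that is both open and closed. The line is connected and
  \<open>char M 0 = 1\<close>, so this set is empty.\<close>

lemma (in real_distribution) frequently_char_neq_0:
  fixes \<beta> t :: real
  assumes int: "integrable M (\<lambda>x. exp (\<beta> * \<bar>x\<bar>))" and \<beta>: "0 < \<beta>"
  shows "\<exists>\<^sub>F u in at t. char M u \<noteq> 0"
proof -
  let ?Z = "{t. \<forall>\<^sub>F u in nhds t. char M u = 0}"
  have "open ?Z"
    unfolding open_subopen[of ?Z] by (auto simp: eventually_nhds)
  moreover have "open (- ?Z)"
    unfolding open_subopen[of "- ?Z"]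
  proof
    fix t assume "t \<in> - ?Z"
    with eventually_char_eq_0_or_neq_0[OF assms, of t] obtain U
      where U: "open U" "t \<in> U" "\<And>u. u \<in> U \<Longrightarrow> u \<noteq> t \<Longrightarrow> char M u \<noteq> 0"
      unfolding eventually_at_topological by auto
    have "U \<subseteq> - ?Z"
      using U(3) \<open>t \<in> - ?Z\<close> by (auto dest: eventually_nhds_x_imp_x)
    with U show "\<exists>T. open T \<and> t \<in> T \<and> T \<subseteq> - ?Z" by blast
  qed
  ultimately have "?Z = {} \<or> ?Z = UNIV"
    using clopen[of ?Z] by (simp add: closed_def)
  moreover have "0 \<notin> ?Z"
    using char_zero by (auto dest: eventually_nhds_x_imp_x)
  ultimately have "\<not> (\<forall>\<^sub>F u in nhds t. char M u = 0)"
    by blast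
  with eventually_char_eq_0_or_neq_0[OF assms, of t] have "\<forall>\<^sub>F u in at t. char M u \<noteq> 0"
    by blast
  then show ?thesis
    by (rule eventually_frequently[rotated]) simp
qed

section \<open>Cancellation of a convolution factor\<close>

text \<open>If \<open>char M\<close> and \<open>char N\<close> differed at \<open>t\<close>, they
  would differ near \<open>t\<close> by continuity, forcing \<open>char K\<close> to vanish on a
  punctured neighbourhood of \<open>t\<close>.\<close>

lemma char_mult_cancel:
  fixes \<beta> :: real
  assumes "real_distribution M" "real_distribution N" "real_distribution K"
    and int: "integrable K (\<lambda>x. exp (\<beta> * \<bar>x\<bar>))" and \<beta>: "0 < \<beta>"
    and eq: "\<And>t. char M t * char K t = char N t * char K t"
  shows "M = N"
proof (rule Levy_uniqueness[OF assms(1,2)], rule ext, rule ccontr)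
  interpret M: real_distribution M by fact
  interpret N: real_distribution N by fact
  interpret K: real_distribution K by fact
  fix t assume "char M t \<noteq> char N t"
  moreover have "((\<lambda>t. char M t - char N t) \<longlongrightarrow> char M t - char N t) (at t)"
    using M.isCont_char[of t] N.isCont_char[of t] unfolding isCont_def by (rule tendsto_diff)
  ultimately have "\<forall>\<^sub>F u in at t. char M u - char N u \<noteq> 0"
    by (intro tendsto_imp_eventually_ne) auto
  then have "\<forall>\<^sub>F u in at t. char K u = 0"
    by eventually_elim (use eq in auto)
  with K.frequently_char_neq_0[OF int \<beta>, of t] show False
    by (simp add: frequently_def)
qed

text \<open>The expectations are the distribution functions of \<open>X\<close> and \<open>Y\<close>
  plus an independent variable of law \<open>K\<close>. Independence is realized on the product of
  \<open>M\<close> and \<open>K\<close>, where Fubini factorizes the characteristic function of the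
  sum, and \<open>char K\<close> is then cancelled.\<close>

lemma (in prob_space) distr_eq_if_convolution_cdf_eq:
  fixes X Y :: "'a \<Rightarrow> real" and \<beta> :: real
  assumes K: "real_distribution K"
    and int: "integrable K (\<lambda>x. exp (\<beta> * \<bar>x\<bar>))" and \<beta>: "0 < \<beta>"
    and X[measurable]: "random_variable borel X" and Y[measurable]: "random_variable borel Y"
    and eq: "\<And>s. expectation (\<lambda>\<omega>. cdf K (s - X \<omega>)) = expectation (\<lambda>\<omega>. cdf K (s - Y \<omega>))"
  shows "distr M borel X = distr M borel Y"
proof -
  interpret K: real_distribution K by fact
  interpret P: pair_prob_space M K by unfold_locales
  define D where "D Z = distr (M \<Otimes>\<^sub>M K) borel (\<lambda>(\<omega>, x). Z \<omega> + x)" for Z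
  have D: "real_distribution (D Z)" if [measurable]: "random_variable borel Z" for Z
    unfolding D_def by (rule P.real_distribution_distr) measurable
  have char_D: "char (D Z) t = char (distr M borel Z) t * char K t"
    if [measurable]: "random_variable borel Z" for Z t
  proof -
    have "char (D Z) t = (CLINT (\<omega>, x)|M \<Otimes>\<^sub>M K. iexp (t * (Z \<omega> + x)))"
      unfolding D_def char_def by (subst integral_distr) (simp_all add: case_prod_unfold)
    also have "\<dots> = (CLINT \<omega>|M. CLINT x|K. iexp (t * (Z \<omega> + x)))"
      by (rule P.integral_fst[symmetric], rule P.integrable_const_bound[where B = 1])
         (auto simp: case_prod_beta norm_exp_i_times simp del: of_real_mult of_real_add)
    also have "\<dots> = (CLINT \<omega>|M. CLINT x|K. iexp (t * Z \<omega>) * iexp (t * x))"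
      by (simp add: exp_add[symmetric] algebra_simps)
    also have "\<dots> = char (distr M borel Z) t * char K t"
      by (simp add: char_def integral_distr)
    finally show ?thesis .
  qed
  have cdf_D: "cdf (D Z) s = expectation (\<lambda>\<omega>. cdf K (s - Z \<omega>))"
    if [measurable]: "random_variable borel Z" for Z s
  proof -
    have [measurable]: "cdf K \<in> borel_measurable borel"
      by (rule borel_measurable_mono) (simp add: mono_def K.cdf_nondecreasing)
    have meas: "(\<lambda>(\<omega>, x). Z \<omega> + x) \<in> borel_measurable (M \<Otimes>\<^sub>M K)"
      by measurable
    have "cdf (D Z) s = measure (M \<Otimes>\<^sub>M K) ((\<lambda>(\<omega>, x). Z \<omega> + x) -` {..s} \<inter> space (M \<Otimes>\<^sub>M K))"
      unfolding D_def cdf_def by (subst measure_distr) auto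
    also have "\<dots> = enn2real (\<integral>\<^sup>+\<omega>. emeasure K
        (Pair \<omega> -` ((\<lambda>(\<omega>, x). Z \<omega> + x) -` {..s} \<inter> space (M \<Otimes>\<^sub>M K))) \<partial>M)"
      unfolding measure_def by (subst K.emeasure_pair_measure_alt[OF measurable_sets[OF meas]]) auto
    also have "\<dots> = enn2real (\<integral>\<^sup>+\<omega>. ennreal (cdf K (s - Z \<omega>)) \<partial>M)"
    proof (intro arg_cong[where f = enn2real] nn_integral_cong)
      fix \<omega> assume "\<omega> \<in> space M"
      then have "Pair \<omega> -` ((\<lambda>(\<omega>, x). Z \<omega> + x) -` {..s} \<inter> space (M \<Otimes>\<^sub>M K)) = {..s - Z \<omega>}"
        by (auto simp: space_pair_measure)
      then show "emeasure K (Pair \<omega> -` ((\<lambda>(\<omega>, x). Z \<omega> + x) -` {..s} \<inter> space (M \<Otimes>\<^sub>M K))) =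
          ennreal (cdf K (s - Z \<omega>))"
        by (simp add: cdf_def K.emeasure_eq_measure)
    qed
    also have "\<dots> = expectation (\<lambda>\<omega>. cdf K (s - Z \<omega>))"
      by (rule integral_eq_nn_integral[symmetric]) (auto simp: K.cdf_nonneg)
    finally show ?thesis .
  qed
  have "D X = D Y"
    by (intro cdf_unique D X Y ext) (simp add: cdf_D eq)
  then have "char (distr M borel X) t * char K t = char (distr M borel Y) t * char K t" for t
    using char_D[OF X, of t] char_D[OF Y, of t] by metis
  then show ?thesis
    by (intro char_mult_cancel[OF _ _ K int \<beta>]) auto
qed

section \<open>Exponential tails and the logarithmic scale\<close>

text \<open>On the shell between \<open>k\<close> and \<open>k + 1\<close> the integrand is at most
  \<open>exp (\<beta> * (k + 1))\<close>. Weighting this by the tail at \<open>k\<close> gives a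
  series dominated, for large \<open>k\<close>, by a geometric one of ratio
  \<open>exp (\<beta> - \<alpha>) < 1\<close>.\<close>

lemma (in real_distribution) integrable_exp_abs_if_tail_bound:
  fixes \<alpha> \<beta> B L :: real
  assumes tail: "\<And>x. L \<le> x \<Longrightarrow> measure M {y. x \<le> \<bar>y\<bar>} \<le> B * exp (- \<alpha> * x)"
    and "0 < \<beta>" "\<beta> < \<alpha>"
  shows "integrable M (\<lambda>x. exp (\<beta> * \<bar>x\<bar>))"
proof (rule integrableI_bounded)
  let ?c = "\<lambda>k::nat. exp (\<beta> * real (k + 1)) * measure M {y. real k \<le> \<bar>y\<bar>}"
  have "summable ?c"
  proof (rule summable_comparison_test_ev)
    have "\<forall>\<^sub>F k in sequentially. L \<le> real k"
      using filterlim_real_sequentially by (simp add: filterlim_at_top)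
    then show "\<forall>\<^sub>F k in sequentially. norm (?c k) \<le> exp \<beta> * B * exp (\<beta> - \<alpha>) ^ k"
    proof eventually_elim
      case (elim k)
      have "?c k \<le> exp (\<beta> * real (k + 1)) * (B * exp (- \<alpha> * real k))"
        by (intro mult_left_mono tail elim) auto
      also have "\<dots> = exp \<beta> * B * exp (\<beta> - \<alpha>) ^ k"
        by (simp add: exp_of_nat_mult[symmetric] exp_add[symmetric] algebra_simps)
      finally show ?case by simp
    qed
    show "summable (\<lambda>k. exp \<beta> * B * exp (\<beta> - \<alpha>) ^ k)"
      using assms by (intro summable_mult summable_geometric) simp
  qed
  have "(\<integral>\<^sup>+x. ennreal (norm (exp (\<beta> * \<bar>x\<bar>))) \<partial>M) \<le>
      (\<integral>\<^sup>+x. (\<Sum>k. ennreal (exp (\<beta> * real (k + 1))) * indicator {y. real k \<le> \<bar>y\<bar>} x) \<partial>M)"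
  proof (rule nn_integral_mono)
    fix x :: real
    define k where "k = nat \<lfloor>\<bar>x\<bar>\<rfloor>"
    have k: "real k \<le> \<bar>x\<bar>" "\<bar>x\<bar> \<le> real (k + 1)"
      unfolding k_def by linarith+
    have "ennreal (norm (exp (\<beta> * \<bar>x\<bar>))) \<le>
        ennreal (exp (\<beta> * real (k + 1))) * indicator {y. real k \<le> \<bar>y\<bar>} x"
      using k \<open>0 < \<beta>\<close> by (simp add: ennreal_leI del: of_nat_add of_nat_Suc)
    also have "\<dots> \<le> (\<Sum>k. ennreal (exp (\<beta> * real (k + 1))) * indicator {y. real k \<le> \<bar>y\<bar>} x)"
      using sum_le_suminf[of "\<lambda>k. ennreal (exp (\<beta> * real (k + 1))) * indicator {y. real k \<le> \<bar>y\<bar>} x" "{k}"]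
      by (simp only: sum.insert_if sum.empty finite.intros empty_iff if_False add_0_right summableI zero_le simp_thms)
    finally show "ennreal (norm (exp (\<beta> * \<bar>x\<bar>))) \<le> \<dots>" .
  qed
  also have "\<dots> = (\<Sum>k. \<integral>\<^sup>+x. ennreal (exp (\<beta> * real (k + 1))) * indicator {y. real k \<le> \<bar>y\<bar>} x \<partial>M)"
    by (rule nn_integral_suminf) measurable
  also have "\<dots> = (\<Sum>k. ennreal (?c k))"
    by (simp add: nn_integral_cmult_indicator emeasure_eq_measure ennreal_mult)
  also have "\<dots> < \<infinity>"
    using \<open>summable ?c\<close> by (simp add: suminf_ennreal2)
  finally show "(\<integral>\<^sup>+x. ennreal (norm (exp (\<beta> * \<bar>x\<bar>))) \<partial>M) < \<infinity>" .
qed simp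


text \<open>The power bound near 0 makes \<open>\<theta>\<close> continuous at 0, and subadditivity
  carries continuity to every point through \<open>\<bar>\<theta> t - \<theta> u\<bar> \<le>
  \<theta> \<bar>t - u\<bar>\<close>. The two power bounds become exponential tail bounds of rate
  \<open>\<alpha>\<close>; the exponent \<open>\<alpha> / 2\<close> is one choice below that
  rate.\<close>

lemma log_scale_distribution:
  fixes \<theta> :: "real \<Rightarrow> real" and \<alpha> m L C :: real
  assumes nonneg: "\<And>t. 0 \<le> t \<Longrightarrow> 0 \<le> \<theta> t"
    and mono: "mono_on {0..} \<theta>"
    and subadd: "\<And>s t. 0 \<le> s \<Longrightarrow> 0 \<le> t \<Longrightarrow> \<theta> (s + t) \<le> \<theta> s + \<theta> t"
    and zero: "\<theta> 0 = 0"
    and lim: "(\<theta> \<longlongrightarrow> 1) at_top"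
    and pos: "0 < \<alpha>" "0 < m" "0 < L"
    and small: "\<And>t. 0 < t \<Longrightarrow> t < m \<Longrightarrow> \<theta> t \<le> C * t powr \<alpha>"
    and large: "\<And>t. L < t \<Longrightarrow> 1 - \<theta> t \<le> C * t powr (- \<alpha>)"
  obtains K where "real_distribution K" "\<And>s. cdf K s = \<theta> (exp s)"
    "integrable K (\<lambda>x. exp (\<alpha> / 2 * \<bar>x\<bar>))"
proof -
  let ?F = "\<lambda>s. \<theta> (exp s)"
  \<comment> \<open>The absolute value turns one-sided continuity at 0 into two-sided continuity, so
    that limits can be composed with it.\<close>
  have \<theta>0: "isCont (\<lambda>h. \<theta> \<bar>h\<bar>) 0"
    unfolding isCont_def
  proof (simp add: zero, rule tendsto_sandwich)
    show "((\<lambda>h. 0) \<longlongrightarrow> 0) (at (0::real))" by simp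
    have "((\<lambda>h::real. \<bar>h\<bar> powr \<alpha>) \<longlongrightarrow> 0) (at 0)"
      by (rule tendsto_zero_powrI[where b = \<alpha>]) (use pos in \<open>auto intro: tendsto_rabs_zero\<close>)
    then show "((\<lambda>h. C * \<bar>h\<bar> powr \<alpha>) \<longlongrightarrow> 0) (at 0)"
      by (rule tendsto_mult_right_zero)
    show "\<forall>\<^sub>F h in at 0. 0 \<le> \<theta> \<bar>h\<bar>"
      by (simp add: nonneg)
    show "\<forall>\<^sub>F h in at 0. \<theta> \<bar>h\<bar> \<le> C * \<bar>h\<bar> powr \<alpha>"
      unfolding eventually_at using pos(2) small by (intro exI[of _ m]) (auto simp: dist_real_def)
  qed
  have monoF: "?F x \<le> ?F y" if "x \<le> y" for x y
    using that by (intro mono_onD[OF mono]) auto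
  have diff: "\<bar>\<theta> t - \<theta> u\<bar> \<le> \<theta> \<bar>t - u\<bar>" if "0 \<le> t" "0 \<le> u" for t u
  proof -
    have "\<theta> t - \<theta> u \<le> \<theta> \<bar>t - u\<bar> \<and> \<theta> u \<le> \<theta> t" if "0 \<le> u" "u \<le> t" for t u
      using subadd[of u "t - u"] mono_onD[OF mono, of u t] that by auto
    from this[of t u] this[of u t] show ?thesis
      using that by (cases "t \<le> u") (auto simp: abs_minus_commute)
  qed
  have contF: "isCont ?F a" for a
    unfolding isCont_def
  proof (rule Lim_null[THEN iffD2], rule Lim_null_comparison)
    show "\<forall>\<^sub>F s in at a. norm (?F s - ?F a) \<le> \<theta> \<bar>exp s - exp a\<bar>"
      by (simp add: diff)
    have "((\<lambda>s. exp s - exp a) \<longlongrightarrow> 0) (at a)"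
      by (rule Lim_null[THEN iffD1]) (intro tendsto_intros)
    from isCont_tendsto_compose[OF \<theta>0 this] show "((\<lambda>s. \<theta> \<bar>exp s - exp a\<bar>) \<longlongrightarrow> 0) (at a)"
      by (simp add: zero)
  qed
  have rcont: "continuous (at_right a) ?F" for a
    using contF[of a] by (rule continuous_at_imp_continuous_at_within)
  have bot: "(?F \<longlongrightarrow> 0) at_bot"
    using isCont_tendsto_compose[OF \<theta>0 exp_at_bot] by (simp add: zero)
  have top: "(?F \<longlongrightarrow> 1) at_top"
    by (rule filterlim_compose[OF lim exp_at_top])
  define K where "K = interval_measure ?F"
  interpret K: real_distribution K
    unfolding K_def by (rule real_distribution_interval_measure[OF monoF rcont bot top])
  have cdf: "cdf K s = \<theta> (exp s)" for s
    unfolding K_def by (simp add: cdf_interval_measure[OF monoF rcont bot])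
  have "integrable K (\<lambda>x. exp (\<alpha> / 2 * \<bar>x\<bar>))"
  proof (rule K.integrable_exp_abs_if_tail_bound)
    \<comment> \<open>The threshold ensures \<open>exp (- x) < m\<close> and
      \<open>L < exp (x - 1)\<close>.\<close>
    fix x assume x: "max (1 - ln m) (ln L + 2) \<le> x"
    \<comment> \<open>The complement of \<open>{..x}\<close> would miss the point \<open>x\<close>;
      stepping back by 1 includes it and only costs the factor \<open>exp \<alpha>\<close> in the
      bound.\<close>
    have "measure K {y. x \<le> \<bar>y\<bar>} \<le> measure K ({..- x} \<union> (UNIV - {..x - 1}))"
      by (rule K.finite_measure_mono) auto
    also have "\<dots> \<le> measure K {..- x} + measure K (UNIV - {..x - 1})"
      by (rule measure_Un_le) auto
    also have "\<dots> = \<theta> (exp (- x)) + (1 - \<theta> (exp (x - 1)))"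
      using K.prob_compl[of "{..x - 1}"] cdf[of "- x"] cdf[of "x - 1"] by (simp add: cdf_def)
    also have "\<dots> \<le> C * exp (- x) powr \<alpha> + C * exp (x - 1) powr (- \<alpha>)"
    proof (intro add_mono small large)
      have "exp (- x) < exp (ln m)" using x by (subst exp_less_cancel_iff) simp
      then show "exp (- x) < m" using pos by simp
      have "exp (ln L) < exp (x - 1)" using x by (subst exp_less_cancel_iff) simp
      then show "L < exp (x - 1)" using pos by simp
    qed simp
    also have "\<dots> = C * (1 + exp \<alpha>) * exp (- \<alpha> * x)"
      by (simp add: powr_def exp_add[symmetric] algebra_simps)
    finally show "measure K {y. x \<le> \<bar>y\<bar>} \<le> C * (1 + exp \<alpha>) * exp (- \<alpha> * x)" .
  qed (use pos in auto)
  then show ?thesis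
    using that[of K] cdf K.real_distribution_axioms by blast
qed

section \<open>Recovering increasing sequences from their averages\<close>

text \<open>Every point has positive mass, so a strict inclusion makes the probabilities differ.
  This applies below to level sets of increasing sequences, which are initial or final segments and
  hence nested.\<close>

lemma measure_pmf_nested_eqD:
  assumes "set_pmf q = UNIV" "A \<subseteq> B \<or> B \<subseteq> A" "measure_pmf.prob q A = measure_pmf.prob q B"
  shows "A = B"
proof -
  have "B \<subseteq> A" if "A \<subseteq> B" "measure_pmf.prob q A = measure_pmf.prob q B" for A B
  proof
    fix n assume "n \<in> B"
    show "n \<in> A"
    proof (rule ccontr)
      assume "n \<notin> A"
      then have "measure_pmf.prob q A + pmf q n = measure_pmf.prob q (A \<union> {n})"
        by (subst measure_pmf.finite_measure_Union) (auto simp: measure_pmf_single)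
      also have "\<dots> \<le> measure_pmf.prob q B"
        using that \<open>n \<in> B\<close> by (intro measure_pmf.finite_measure_mono) auto
      finally show False
        using that assms(1) by (metis UNIV_I add_le_same_cancel1 linorder_not_less pmf_positive_iff)
    qed
  qed
  then show ?thesis
    using assms(2,3) by (metis subset_antisym)
qed

text \<open>With \<open>t = exp s\<close>, the number \<open>\<theta> (t * a n)\<close> is
  \<open>cdf K\<close> at \<open>s - (- ln (a n))\<close>, so cancelling \<open>K\<close> identifies
  the laws of \<open>- ln a\<close> and \<open>- ln b\<close> under \<open>q\<close>.\<close>

lemma prob_le_eq_if_theta_expectations_eq:
  fixes a b :: "'n \<Rightarrow> real" and \<theta> :: "real \<Rightarrow> real" and \<beta> :: real
  assumes K: "real_distribution K" "\<And>s. cdf K s = \<theta> (exp s)"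
    and int: "integrable K (\<lambda>x. exp (\<beta> * \<bar>x\<bar>))" "0 < \<beta>"
    and a: "\<And>n. 0 < a n" and b: "\<And>n. 0 < b n"
    and eq: "\<And>t. 0 < t \<Longrightarrow> measure_pmf.expectation q (\<lambda>n. \<theta> (t * a n)) =
                            measure_pmf.expectation q (\<lambda>n. \<theta> (t * b n))"
  shows "measure_pmf.prob q {n. a n \<le> u} = measure_pmf.prob q {n. b n \<le> u}"
proof (cases "0 < u")
  case True
  have "distr q borel (\<lambda>n. - ln (a n)) = distr q borel (\<lambda>n. - ln (b n))"
  proof (rule measure_pmf.distr_eq_if_convolution_cdf_eq[OF K(1) int])
    fix s
    show "measure_pmf.expectation q (\<lambda>n. cdf K (s - - ln (a n))) =
        measure_pmf.expectation q (\<lambda>n. cdf K (s - - ln (b n)))"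
      using eq[of "exp s"] a b by (simp add: K(2) exp_add)
  qed simp_all
  then have "measure (distr q borel (\<lambda>n. - ln (a n))) {- ln u..} =
      measure (distr q borel (\<lambda>n. - ln (b n))) {- ln u..}"
    by simp
  moreover have "(\<lambda>n. - ln (c n)) -` {- ln u..} = {n. c n \<le> u}" if "\<And>n. 0 < c n" for c :: "'n \<Rightarrow> real"
    using that True by auto
  ultimately show ?thesis
    using a b by (simp add: measure_distr)
next
  case False
  then have "{n. a n \<le> u} = {}" "{n. b n \<le> u} = {}"
    using a b by (auto simp: not_le not_less intro: le_less_trans)
  then show ?thesis by simp
qed

text \<open>Letting \<open>t\<close> tend to infinity shows that \<open>a\<close> and
  \<open>b\<close> vanish at the same indices; the logarithmic argument handles the others. All
  sublevel sets then have equal probability and, being nested, coincide.\<close>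

lemma eq_if_theta_expectations_eq:
  fixes a b :: "nat \<Rightarrow> real" and \<theta> :: "real \<Rightarrow> real" and \<beta> :: real
  assumes K: "real_distribution K" "\<And>s. cdf K s = \<theta> (exp s)"
    and int: "integrable K (\<lambda>x. exp (\<beta> * \<bar>x\<bar>))" "0 < \<beta>"
    and zero: "\<theta> 0 = 0"
    and q: "set_pmf q = UNIV"
    and a: "\<And>n. 0 \<le> a n" "mono a" and b: "\<And>n. 0 \<le> b n" "mono b"
    and eq: "\<And>t. 0 < t \<Longrightarrow> measure_pmf.expectation q (\<lambda>n. \<theta> (t * a n)) =
                            measure_pmf.expectation q (\<lambda>n. \<theta> (t * b n))"
  shows "a = b"
proof -
  interpret K: real_distribution K by fact
  have \<theta>_cdf: "\<theta> t = (if 0 < t then cdf K (ln t) else 0)" if "0 \<le> t" for t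
    using that zero K(2)[of "ln t"] by auto
  have \<theta>_bound: "0 \<le> \<theta> t" "\<theta> t \<le> 1" if "0 \<le> t" for t
    using that by (simp_all add: \<theta>_cdf K.cdf_nonneg K.cdf_bounded_prob)
  have lim: "(\<theta> \<longlongrightarrow> 1) at_top"
  proof (rule Lim_transform_eventually)
    show "((\<lambda>t. cdf K (ln t)) \<longlongrightarrow> 1) at_top"
      by (rule filterlim_compose[OF K.cdf_lim_at_top_prob ln_at_top])
    show "\<forall>\<^sub>F t in at_top. cdf K (ln t) = \<theta> t"
      using eventually_gt_at_top[of 0] by eventually_elim (simp add: \<theta>_cdf)
  qed
  \<comment> \<open>Dominated convergence: \<open>\<theta> (t * c n)\<close> tends to 1 if
    \<open>c n\<close> is positive and is 0 otherwise.\<close>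
  have prob_pos: "((\<lambda>t. measure_pmf.expectation q (\<lambda>n. \<theta> (t * c n))) \<longlongrightarrow>
      measure_pmf.prob q {n. 0 < c n}) at_top" if c: "\<And>n. 0 \<le> c n" for c :: "nat \<Rightarrow> real"
  proof -
    have "((\<lambda>t. measure_pmf.expectation q (\<lambda>n. \<theta> (t * c n))) \<longlongrightarrow>
      measure_pmf.expectation q (indicator {n. 0 < c n})) at_top"
    proof (rule integral_dominated_convergence_at_top[where w = "\<lambda>_. 1"])
      show "\<forall>\<^sub>F t in at_top. AE n in q. norm (\<theta> (t * c n)) \<le> 1"
        using eventually_gt_at_top[of 0] by eventually_elim (use c \<theta>_bound in \<open>simp add: abs_le_iff\<close>)
      show "AE n in q. ((\<lambda>t. \<theta> (t * c n)) \<longlongrightarrow> indicator {n. 0 < c n} n) at_top"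
      proof (rule AE_I2)
        fix n
        show "((\<lambda>t. \<theta> (t * c n)) \<longlongrightarrow> indicator {n. 0 < c n} n) at_top"
        proof (cases "0 < c n")
          case True
          then have "filterlim (\<lambda>t. t * c n) at_top at_top"
            by (intro filterlim_at_top_mult_tendsto_pos[OF tendsto_const] filterlim_ident)
          from filterlim_compose[OF lim this] show ?thesis
            using True by simp
        next
          case False
          with c[of n] show ?thesis by (simp add: zero)
        qed
      qed
    qed simp_all
    then show ?thesis by simp
  qed
  have "measure_pmf.prob q {n. 0 < a n} = measure_pmf.prob q {n. 0 < b n}"
  proof (rule tendsto_unique[OF _ _ prob_pos[OF b(1)]])
    show "((\<lambda>t. measure_pmf.expectation q (\<lambda>n. \<theta> (t * b n))) \<longlongrightarrow>
      measure_pmf.prob q {n. 0 < a n}) at_top"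
      by (rule Lim_transform_eventually[OF prob_pos[OF a(1)]])
         (use eventually_gt_at_top[of 0] in \<open>eventually_elim; use eq in simp\<close>)
  qed simp
  moreover have "{n. 0 < a n} \<subseteq> {n. 0 < b n} \<or> {n. 0 < b n} \<subseteq> {n. 0 < a n}"
    using monoD[OF a(2)] monoD[OF b(2)]
    by (smt (verit, ccfv_threshold) mem_Collect_eq nat_le_linear subsetI)
  ultimately have S: "{n. 0 < a n} = {n. 0 < b n}"
    by (intro measure_pmf_nested_eqD[OF q])
  txt \<open>
    Indices with \<open>a n = 0\<close> have no logarithm. They are the same for \<open>a\<close> and \<open>b\<close>, so resetting both
    values to 1 there changes both expectations by the same amount.
  \<close>
  define a' where "a' n = (if 0 < a n then a n else 1)" for n
  define b' where "b' n = (if 0 < b n then b n else 1)" for n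
  let ?Z = "{n. \<not> 0 < a n}"
  have Z: "?Z = {n. \<not> 0 < b n}"
    using S by auto
  have shift: "measure_pmf.expectation q (\<lambda>n. \<theta> (t * (if 0 < c n then c n else 1))) =
      measure_pmf.expectation q (\<lambda>n. \<theta> (t * c n)) + measure_pmf.prob q {n. \<not> 0 < c n} * \<theta> t"
    if c: "\<And>n. 0 \<le> c n" and "0 < t" for c :: "nat \<Rightarrow> real" and t
  proof -
    have "\<theta> (t * (if 0 < c n then c n else 1)) = \<theta> (t * c n) + indicator {n. \<not> 0 < c n} n * \<theta> t" for n
      using c[of n] zero by (auto simp: indicator_def)
    moreover have "integrable q (\<lambda>n. \<theta> (t * c n))"
      by (rule measure_pmf.integrable_const_bound[where B = 1])
         (use c \<theta>_bound \<open>0 < t\<close> in \<open>simp_all add: abs_le_iff\<close>)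
    moreover have "integrable q (\<lambda>n. indicator {n. \<not> 0 < c n} n * \<theta> t)"
      by (rule measure_pmf.integrable_const_bound[where B = "\<bar>\<theta> t\<bar>"])
         (simp_all add: indicator_def)
    ultimately show ?thesis
      by (simp add: mult.commute)
  qed
  \<comment> \<open>Moving the zero values to 1 removes their indices from the sublevel set exactly
    when \<open>u < 1\<close>.\<close>
  have level: "measure_pmf.prob q {n. c n \<le> u} =
      measure_pmf.prob q {n. (if 0 < c n then c n else 1) \<le> u} +
      (if 1 \<le> u then 0 else measure_pmf.prob q {n. \<not> 0 < c n})"
    if c: "\<And>n. 0 \<le> c n" and "0 \<le> u" for c :: "nat \<Rightarrow> real" and u
  proof (cases "1 \<le> u")
    case True
    then have "{n. c n \<le> u} = {n. (if 0 < c n then c n else 1) \<le> u}"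
      by auto
    with True show ?thesis by simp
  next
    case False
    then have "{n. c n \<le> u} = {n. (if 0 < c n then c n else 1) \<le> u} \<union> {n. \<not> 0 < c n}"
      using that by (auto split: if_splits)
    then have "measure_pmf.prob q {n. c n \<le> u} =
        measure_pmf.prob q ({n. (if 0 < c n then c n else 1) \<le> u} \<union> {n. \<not> 0 < c n})"
      by simp
    also have "\<dots> = measure_pmf.prob q {n. (if 0 < c n then c n else 1) \<le> u} +
        measure_pmf.prob q {n. \<not> 0 < c n}"
      using False by (intro measure_pmf.finite_measure_Union) (auto split: if_splits)
    finally show ?thesis using False by simp
  qed
  have prob': "measure_pmf.prob q {n. a' n \<le> u} = measure_pmf.prob q {n. b' n \<le> u}" for u
  proof (rule prob_le_eq_if_theta_expectations_eq[OF K int])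
    fix t :: real assume "0 < t"
    then show "measure_pmf.expectation q (\<lambda>n. \<theta> (t * a' n)) = measure_pmf.expectation q (\<lambda>n. \<theta> (t * b' n))"
      unfolding a'_def b'_def using shift[OF a(1)] shift[OF b(1)] eq Z by simp
  qed (auto simp: a'_def b'_def)
  have iff: "a n \<le> u \<longleftrightarrow> b n \<le> u" if "0 \<le> u" for n u
  proof -
    have "measure_pmf.prob q {n. a n \<le> u} = measure_pmf.prob q {n. b n \<le> u}"
      using level[OF a(1) that] level[OF b(1) that] prob'[of u] Z
      unfolding a'_def b'_def by simp
    moreover have "{n. a n \<le> u} \<subseteq> {n. b n \<le> u} \<or> {n. b n \<le> u} \<subseteq> {n. a n \<le> u}"
      using monoD[OF a(2)] monoD[OF b(2)]
      by (smt (verit, ccfv_threshold) mem_Collect_eq nat_le_linear subsetI)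
    ultimately have "{n. a n \<le> u} = {n. b n \<le> u}"
      by (intro measure_pmf_nested_eqD[OF q])
    then show ?thesis by auto
  qed
  show ?thesis
    \<comment> \<open>The equivalence is used at the levels \<open>u = b n\<close> and
      \<open>u = a n\<close>.\<close>
    using iff a(1) b(1) by (intro ext antisym) blast+
qed

section \<open>Normalized weights and the equivalence of the two conditions\<close>

lemma pmf_nat_normalize:
  fixes r :: "nat \<Rightarrow> real"
  assumes "\<And>n. 0 < r n" "summable r"
  obtains q where "\<And>n. pmf q n = r n / suminf r"
proof
  have pos: "0 < suminf r"
    using assms by (intro suminf_pos)
  fix n
  show "pmf (embed_pmf (\<lambda>n. r n / suminf r)) n = r n / suminf r"
  proof (rule pmf_embed_pmf)
    show "0 \<le> r n / suminf r" for n
      using pos assms(1)[of n] by simp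
    then show "(\<integral>\<^sup>+n. ennreal (r n / suminf r) \<partial>count_space UNIV) = 1"
      using pos assms(2)
      by (simp add: nn_integral_count_space_nat suminf_ennreal2 summable_divide suminf_divide)
  qed
qed

lemma expectation_pmf_nat:
  fixes f :: "nat \<Rightarrow> real"
  assumes "\<And>n. \<bar>f n\<bar> \<le> B"
  shows "measure_pmf.expectation q f = (\<Sum>n. pmf q n * f n)"
proof -
  have "integrable q f"
    by (rule measure_pmf.integrable_const_bound[where B = B]) (use assms in simp_all)
  then have "integrable (count_space UNIV) (\<lambda>n. pmf q n * f n)"
    by (simp add: measure_pmf_eq_density integrable_density)
  then show ?thesis
    by (simp add: measure_pmf_eq_density integral_density integral_count_space_nat)
qed

theorem corollary2p3:
  fixes p :: "nat \<Rightarrow> 'a::{real_vector, t2_space} \<Rightarrow> real"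
    and \<theta> :: "real \<Rightarrow> real"
    and r :: "nat \<Rightarrow> real"
    and T :: "'a \<Rightarrow> 'a"
  assumes "frechet_space TYPE('a)"
    and "\<And>n. seminorm (p n)"
    and "\<And>n x. p n x \<le> p (Suc n) x"
    and "topology_defined_by p"
    and "\<And>t. 0 \<le> t \<Longrightarrow> 0 \<le> \<theta> t"
    and "mono_on {0..} \<theta>"
    and "\<And>s t. 0 \<le> s \<Longrightarrow> 0 \<le> t \<Longrightarrow> \<theta> (s + t) \<le> \<theta> s + \<theta> t"
    and "\<theta> 0 = 0"
    and "(\<theta> \<longlongrightarrow> 1) at_top"
    and "absolutely_continuous_map {0..} \<theta>"
    and "\<exists>\<alpha> m M C. 0 < \<alpha> \<and> 0 < m \<and> 0 < M \<and> 0 < C \<and>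
           (\<forall>t. 0 < t \<and> t < m \<longrightarrow> \<theta> t \<le> C * t powr \<alpha>) \<and>
           (\<forall>t > M. 1 - \<theta> t \<le> C * t powr (- \<alpha>))"
    and "\<And>n. 0 < r n"
    and "summable r"
    and "linear T"
    and "continuous_on UNIV T"
  shows "(\<forall>x. theta_dist \<theta> r p (T x) 0 = theta_dist \<theta> r p x 0) \<longleftrightarrow>
         (\<forall>x n. p n (T x) = p n x)"
proof
  assume iso: "\<forall>x. theta_dist \<theta> r p (T x) 0 = theta_dist \<theta> r p x 0"
  obtain \<alpha> m M C where \<alpha>: "0 < \<alpha>" "0 < m" "0 < M"
      "\<And>t. 0 < t \<Longrightarrow> t < m \<Longrightarrow> \<theta> t \<le> C * t powr \<alpha>"
      "\<And>t. M < t \<Longrightarrow> 1 - \<theta> t \<le> C * t powr (- \<alpha>)"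
    using assms(11) by blast
  obtain K where K: "real_distribution K" "\<And>s. cdf K s = \<theta> (exp s)"
      "integrable K (\<lambda>x. exp (\<alpha> / 2 * \<bar>x\<bar>))"
    using log_scale_distribution[OF assms(5-9) \<alpha>] by blast
  interpret K: real_distribution K by fact
  have \<theta>_bound: "\<bar>\<theta> t\<bar> \<le> 1" if "0 \<le> t" for t
  proof (cases "t = 0")
    case False
    with that K(2)[of "ln t"] K.cdf_bounded_prob[of "ln t"] K.cdf_nonneg[of "ln t"] show ?thesis
      by simp
  qed (simp add: assms(8))
  obtain q where q: "\<And>n. pmf q n = r n / suminf r"
    using pmf_nat_normalize[OF assms(12,13)] by blast
  have pos: "0 < suminf r"
    using assms(12,13) by (intro suminf_pos)
  have set_q: "set_pmf q = UNIV"
    using q pos assms(12) by (auto simp: set_pmf_iff less_imp_neq[symmetric])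
  have nonneg: "0 \<le> p n x" and scale: "p n (c *\<^sub>R x) = \<bar>c\<bar> * p n x" for n c x
    using assms(2)[of n] by (auto simp: seminorm_def)
  have mono: "mono (\<lambda>n. p n x)" for x
    using assms(3) by (simp add: mono_iff_le_Suc)
  \<comment> \<open>Homogeneity of the seminorms turns the distance of a multiple of
    \<open>x\<close> from 0 into an average of \<open>\<theta>\<close> at dilated arguments;
    \<open>suminf r\<close> undoes the normalization of the weights.\<close>
  have dist: "theta_dist \<theta> r p (t *\<^sub>R x) 0 =
      suminf r * measure_pmf.expectation q (\<lambda>n. \<theta> (t * p n x))" if "0 < t" for t x
  proof -
    have bd: "\<bar>\<theta> (t * p n x)\<bar> \<le> 1" for n
      using that nonneg by (intro \<theta>_bound) simp
    have "summable (\<lambda>n. r n * \<theta> (t * p n x))"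
      by (rule summable_comparison_test'[OF assms(13)])
         (use bd assms(12) in \<open>simp add: abs_mult mult_left_le less_imp_le\<close>)
    then show ?thesis
      using that pos
      by (simp add: theta_dist_def scale expectation_pmf_nat[OF bd] q suminf_divide)
  qed
  have "(\<lambda>n. p n (T x)) = (\<lambda>n. p n x)" for x
  proof (rule eq_if_theta_expectations_eq[OF K _ assms(8) set_q])
    fix t :: real assume "0 < t"
    \<comment> \<open>Linearity of \<open>T\<close> makes condition (i) available along the whole
      ray through \<open>x\<close>.\<close>
    have "theta_dist \<theta> r p (t *\<^sub>R T x) 0 = theta_dist \<theta> r p (t *\<^sub>R x) 0"
      using iso linear_scale[OF assms(14)] by metis
    then show "measure_pmf.expectation q (\<lambda>n. \<theta> (t * p n (T x))) =
        measure_pmf.expectation q (\<lambda>n. \<theta> (t * p n x))"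
      using dist[OF \<open>0 < t\<close>] pos by simp
  qed (use \<alpha> nonneg mono in auto)
  then show "\<forall>x n. p n (T x) = p n x"
    by metis
\<comment> \<open>In the converse direction the two series agree term by term.\<close>
qed (simp add: theta_dist_def)

end
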